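(* Let $T\subset\mathbb{R}^2$ be a nondegenerate triangle and let $\mu>-1$. Then the linear functionals $$\mathcal{G}_{j,\mu}^{\mathrm{enr}}(f)=\int_0^1 t^{\mu}(1-t)^{\mu} f\left(t\boldsymbol{m}_{j}+(1-t)\boldsymbol{m}^{\star}\right)dt,\qquad f\in C(T),\ j=1,2,3,$$ are admissible, i.e. the $3\times3$ matrix $N=\left[\mathcal{G}_{j,\mu}^{\mathrm{enr}}(\varphi_i)\right]_{j,i=1,2,3}$ satisfies $\det(N)\neq 0$.
   Context: $T$ has vertices $\boldsymbol{v}_1,\boldsymbol{v}_2,\boldsymbol{v}_3$ (oriented counterclockwise) and barycentric coordinates $\lambda_1,\lambda_2,\lambda_3$. The edge midpoints are $\boldsymbol{m}_1=\frac{\boldsymbol{v}_2+\boldsymbol{v}_3}{2}$, $\boldsymbol{m}_2=\frac{\boldsymbol{v}_3+\boldsymbol{v}_1}{2}$, $\boldsymbol{m}_3=\frac{\boldsymbol{v}_1+\boldsymbol{v}_2}{2}$, and $\boldsymbol{m}^{\star}=\frac{\boldsymbol{v}_1+\boldsymbol{v}_2+\boldsymbol{v}_3}{3}$ is the barycenter. $C(T)$ is the space of continuous real functions on $T$. The functions $\varphi_i$ are $$\varphi_1=\lambda_1(1-3\lambda_2-3\lambda_3),\quad \varphi_2=\lambda_2(1-3\lambda_1-3\lambda_3),\quad \varphi_3=\lambda_3(1-3\lambda_1-3\lambda_2).$$ In $N$, $j$ is the row index and $i$ the column index. *)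

theory Defs
  imports "HOL-Analysis.Analysis"
begin

text \<open>
  Vertices are indexed by the type \<^typ>\<open>3\<close>, whose arithmetic is modulo 3 (so \<open>3 = 0\<close>);
  \<open>i + 1\<close> and \<open>i + 2\<close> are the other two indices in cyclic order, e.g. \<open>2 + 1 = 3\<close> and
  \<open>2 + 2 = 1\<close>.
\<close>

definition triangle :: "(3 \<Rightarrow> real^2) \<Rightarrow> (real^2) set" where
  "triangle v = convex hull {v 1, v 2, v 3}"

text \<open>The determinant is twice the signed area.\<close>
definition counterclockwise :: "(3 \<Rightarrow> real^2) \<Rightarrow> bool" where
  "counterclockwise v \<longleftrightarrow> det (vector [v 2 - v 1, v 3 - v 1] :: real^2^2) > 0"

definition barycentric :: "(3 \<Rightarrow> real^2) \<Rightarrow> real^2 \<Rightarrow> real^3" where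
  "barycentric v x =
     (THE l. (\<Sum>i\<in>UNIV. l $ i) = 1 \<and> (\<Sum>i\<in>UNIV. l $ i *\<^sub>R v i) = x)"

definition edge_midpoint :: "(3 \<Rightarrow> real^2) \<Rightarrow> 3 \<Rightarrow> real^2" where
  "edge_midpoint v j = (1/2) *\<^sub>R (v (j + 1) + v (j + 2))"

definition barycenter :: "(3 \<Rightarrow> real^2) \<Rightarrow> real^2" where
  "barycenter v = (1/3) *\<^sub>R (v 1 + v 2 + v 3)"

definition phi :: "(3 \<Rightarrow> real^2) \<Rightarrow> 3 \<Rightarrow> real^2 \<Rightarrow> real" where
  "phi v i x = barycentric v x $ i *
     (1 - 3 * barycentric v x $ (i + 1) - 3 * barycentric v x $ (i + 2))"

text \<open>
  \<open>C(T)\<close>: an element is represented by any function on the plane that is continuous on \<open>T\<close>;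
  only its values on \<open>T\<close> matter (see \<open>enr_functional_cong\<close> below).
\<close>
definition CT :: "(3 \<Rightarrow> real^2) \<Rightarrow> (real^2 \<Rightarrow> real) set" where
  "CT v = {f. continuous_on (triangle v) f}"

text \<open>
  A Lebesgue integral; the integrand is integrable for \<open>\<mu> > -1\<close> and \<open>f \<in> C(T)\<close>
  (\<open>enr_functional_integrable\<close>). The value of \<open>powr\<close> at the endpoints is irrelevant.
\<close>
definition enr_functional :: "real \<Rightarrow> (3 \<Rightarrow> real^2) \<Rightarrow> 3 \<Rightarrow> (real^2 \<Rightarrow> real) \<Rightarrow> real" where
  "enr_functional \<mu> v j = (\<lambda>f\<in>CT v.
     LINT t:{0..1}|lborel. t powr \<mu> * (1 - t) powr \<mu> *
       f (t *\<^sub>R edge_midpoint v j + (1 - t) *\<^sub>R barycenter v))"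

definition admissible :: "(3 \<Rightarrow> real^2) \<Rightarrow> (3 \<Rightarrow> (real^2 \<Rightarrow> real) \<Rightarrow> real) \<Rightarrow> bool" where
  "admissible v G \<longleftrightarrow> det (\<chi> j i. G j (phi v i) :: real^3^3) \<noteq> 0"


subsection \<open>Well-definedness\<close>

lemma three_cyclic:
  "(2::3) + 1 = 3" "(2::3) + 2 = 1" "(3::3) + 1 = 1" "(3::3) + 2 = 2" "(1::3) + 1 = 2"
  "(1::3) + 2 = 3"
  by simp_all

lemma
  shows edge_midpoint_1: "edge_midpoint v 1 = (1/2) *\<^sub>R (v 2 + v 3)"
    and edge_midpoint_2: "edge_midpoint v 2 = (1/2) *\<^sub>R (v 3 + v 1)"
    and edge_midpoint_3: "edge_midpoint v 3 = (1/2) *\<^sub>R (v 1 + v 2)"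
  unfolding edge_midpoint_def three_cyclic by simp_all

lemma det_nonzero_of_noncollinear:
  fixes v :: "3 \<Rightarrow> real^2"
  assumes "\<not> collinear {v 1, v 2, v 3}"
  shows "(v 2 - v 1) $ 1 * (v 3 - v 1) $ 2 - (v 2 - v 1) $ 2 * (v 3 - v 1) $ 1 \<noteq> 0"
proof
  assume D: "(v 2 - v 1) $ 1 * (v 3 - v 1) $ 2 - (v 2 - v 1) $ 2 * (v 3 - v 1) $ 1 = 0"
  have "{v 2, v 1, v 3} = {v 1, v 2, v 3}" by auto
  then have nc: "\<not> collinear {0, v 2 - v 1, v 3 - v 1}"
    using assms collinear_3[of "v 2" "v 1" "v 3"] by simp
  define a where "a = v 2 - v 1"
  define b where "b = v 3 - v 1"
  have "a \<noteq> 0" using nc by (auto simp: collinear_lemma a_def)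
  then consider "a $ 1 \<noteq> 0" | "a $ 2 \<noteq> 0"
    by (auto simp: vec_eq_iff forall_2)
  then have "\<exists>c. b = c *\<^sub>R a"
  proof cases
    case 1
    then have "b = (b $ 1 / a $ 1) *\<^sub>R a"
      using D by (simp add: vec_eq_iff forall_2 a_def[symmetric] b_def[symmetric] field_simps)
    then show ?thesis ..
  next
    case 2
    then have "b = (b $ 2 / a $ 2) *\<^sub>R a"
      using D by (simp add: vec_eq_iff forall_2 a_def[symmetric] b_def[symmetric] field_simps)
    then show ?thesis ..
  qed
  with nc show False by (auto simp: collinear_lemma a_def b_def)
qed

lemma barycentric_ex1:
  fixes v :: "3 \<Rightarrow> real^2"
  assumes "\<not> collinear {v 1, v 2, v 3}"
  shows "\<exists>!l::real^3. (\<Sum>i\<in>UNIV. l $ i) = 1 \<and> (\<Sum>i\<in>UNIV. l $ i *\<^sub>R v i) = x"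
proof -
  define D where
    "D = (v 2 - v 1) $ 1 * (v 3 - v 1) $ 2 - (v 2 - v 1) $ 2 * (v 3 - v 1) $ 1"
  have D: "D \<noteq> 0" using det_nonzero_of_noncollinear[OF assms] by (simp add: D_def)
  define p where "p = ((x - v 1) $ 1 * (v 3 - v 1) $ 2 - (x - v 1) $ 2 * (v 3 - v 1) $ 1) / D"
  define q where "q = ((v 2 - v 1) $ 1 * (x - v 1) $ 2 - (v 2 - v 1) $ 2 * (x - v 1) $ 1) / D"
  have p: "p * D = (x - v 1) $ 1 * (v 3 - v 1) $ 2 - (x - v 1) $ 2 * (v 3 - v 1) $ 1"
    and q: "q * D = (v 2 - v 1) $ 1 * (x - v 1) $ 2 - (v 2 - v 1) $ 2 * (x - v 1) $ 1"
    using D by (simp_all add: p_def q_def)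
  have e: "p * (v 2 - v 1) $ k + q * (v 3 - v 1) $ k = (x - v 1) $ k" for k
  proof -
    have "(p * (v 2 - v 1) $ k + q * (v 3 - v 1) $ k) * D
        = (p * D) * (v 2 - v 1) $ k + (q * D) * (v 3 - v 1) $ k"
      by (simp add: algebra_simps)
    also have "\<dots> = (x - v 1) $ k * D"
      unfolding p q unfolding D_def using exhaust_2[of k] by (auto simp: algebra_simps)
    finally show ?thesis using D by simp
  qed
  show ?thesis
  proof (rule ex1I[where a = "vector [1 - p - q, p, q]"])
    have "(1 - p - q) *\<^sub>R v 1 + p *\<^sub>R v 2 + q *\<^sub>R v 3 = x"
      using e by (auto simp: vec_eq_iff algebra_simps)
    then show "(\<Sum>i\<in>UNIV. (vector [1 - p - q, p, q] :: real^3) $ i) = 1 \<and>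
        (\<Sum>i\<in>UNIV. (vector [1 - p - q, p, q] :: real^3) $ i *\<^sub>R v i) = x"
      by (simp add: sum_3)
  next
    fix l :: "real^3"
    assume l: "(\<Sum>i\<in>UNIV. l $ i) = 1 \<and> (\<Sum>i\<in>UNIV. l $ i *\<^sub>R v i) = x"
    then have l1: "l $ 1 = 1 - l $ 2 - l $ 3" by (simp add: sum_3)
    have x: "x $ k = l $ 1 * v 1 $ k + l $ 2 * v 2 $ k + l $ 3 * v 3 $ k" for k
      using l by (auto simp: sum_3)
    have xk: "(x - v 1) $ k = l $ 2 * (v 2 - v 1) $ k + l $ 3 * (v 3 - v 1) $ k" for k
      by (simp add: x l1 algebra_simps)
    have "p * D = l $ 2 * D" "q * D = l $ 3 * D"
      unfolding p q xk unfolding D_def by (simp_all add: algebra_simps)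
    then have "p = l $ 2" "q = l $ 3" using D by auto
    then show "l = vector [1 - p - q, p, q]"
      by (simp add: vec_eq_iff forall_3 l1)
  qed
qed

lemma barycentric:
  fixes v :: "3 \<Rightarrow> real^2"
  assumes "\<not> collinear {v 1, v 2, v 3}"
  shows "(\<Sum>i\<in>UNIV. barycentric v x $ i) = 1" "(\<Sum>i\<in>UNIV. barycentric v x $ i *\<^sub>R v i) = x"
  using theI'[OF barycentric_ex1[OF assms, of x]] unfolding barycentric_def by auto

lemma segment_in_triangle:
  assumes "t \<in> {0..1}"
  shows "t *\<^sub>R edge_midpoint v j + (1 - t) *\<^sub>R barycenter v \<in> triangle v"
proof -
  let ?T = "convex hull {v 1, v 2, v 3}"
  have v: "v i \<in> ?T" for i
    using exhaust_3[of i] by (auto intro: hull_inc)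
  have "edge_midpoint v j = (1/2) *\<^sub>R v (j + 1) + (1/2) *\<^sub>R v (j + 2)"
    by (simp add: edge_midpoint_def scaleR_right_distrib)
  then have m: "edge_midpoint v j \<in> ?T"
    using convexD[OF convex_convex_hull v v, of "1/2" "1/2"] by simp
  have "barycenter v = (1/3) *\<^sub>R v 1 + (1/3) *\<^sub>R v 2 + (1/3) *\<^sub>R v 3"
    by (simp add: barycenter_def scaleR_right_distrib)
  then have "barycenter v \<in> ?T"
    unfolding convex_hull_3 by force
  with m show ?thesis
    using assms unfolding triangle_def by (intro convexD[OF convex_convex_hull]) auto
qed

lemma enr_functional_integrable:
  assumes "\<mu> > -1" "f \<in> CT v"
  shows "set_integrable lborel {0..1} (\<lambda>t. t powr \<mu> * (1 - t) powr \<mu> *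
           f (t *\<^sub>R edge_midpoint v j + (1 - t) *\<^sub>R barycenter v))"
proof -
  let ?g = "\<lambda>t. f (t *\<^sub>R edge_midpoint v j + (1 - t) *\<^sub>R barycenter v)"
  have c: "continuous_on {0..1} ?g"
    using assms(2) segment_in_triangle unfolding CT_def
    by (auto intro!: continuous_on_compose2[of "triangle v" f] continuous_intros)
  then have "bounded (?g ` {0..1})"
    by (intro compact_imp_bounded compact_continuous_image) auto
  then obtain B where "\<forall>y\<in>?g ` {0..1}. norm y \<le> B"
    unfolding bounded_iff by blast
  then have B: "\<bar>?g t\<bar> \<le> B" if "t \<in> {0..1}" for t
    using that by (simp only: ball_simps real_norm_def)
  have w: "set_integrable lborel {0..1} (\<lambda>t. t powr \<mu> * (1 - t) powr \<mu>)"
    using integrable_Beta[of "\<mu> + 1" "\<mu> + 1"] assms(1) by simp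
  have gm: "set_borel_measurable lborel {0..1} ?g"
    using borel_measurable_continuous_on_indicator[OF _ c]
    by (simp add: set_borel_measurable_def)
  have "set_integrable lborel {0..1} (\<lambda>t. B * (t powr \<mu> * (1 - t) powr \<mu>))"
    using w by simp
  then show ?thesis
  proof (rule set_integrable_bound)
    have "(\<lambda>t. (indicator {0..1} t *\<^sub>R (t powr \<mu> * (1 - t) powr \<mu>)) * (indicator {0..1} t *\<^sub>R ?g t))
        \<in> borel_measurable lborel"
      using gm unfolding set_borel_measurable_def by measurable
    then show "set_borel_measurable lborel {0..1} (\<lambda>t. t powr \<mu> * (1 - t) powr \<mu> * ?g t)"
      unfolding set_borel_measurable_def
      by (rule measurable_cong[THEN iffD1, rotated]) (simp add: indicator_def)
    show "AE t in lborel. t \<in> {0..1} \<longrightarrow> norm (t powr \<mu> * (1 - t) powr \<mu> * ?g t)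
        \<le> norm (B * (t powr \<mu> * (1 - t) powr \<mu>))"
    proof (intro AE_I2 impI)
      fix t :: real assume t: "t \<in> {0..1}"
      have "\<bar>?g t\<bar> * (t powr \<mu> * (1 - t) powr \<mu>) \<le> \<bar>B\<bar> * (t powr \<mu> * (1 - t) powr \<mu>)"
        by (rule mult_right_mono) (use B[OF t] in auto)
      then show "norm (t powr \<mu> * (1 - t) powr \<mu> * ?g t)
          \<le> norm (B * (t powr \<mu> * (1 - t) powr \<mu>))"
        by (simp add: abs_mult mult_ac)
    qed
  qed
qed

lemma enr_functional_cong:
  assumes "\<And>x. x \<in> triangle v \<Longrightarrow> f x = g x"
  shows "enr_functional \<mu> v j f = enr_functional \<mu> v j g"
proof -
  have "f \<in> CT v \<longleftrightarrow> g \<in> CT v"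
    unfolding CT_def using continuous_on_cong[OF refl assms] by simp
  then show ?thesis
    unfolding enr_functional_def restrict_def
    using assms[OF segment_in_triangle]
    by (auto intro!: set_lebesgue_integral_cong)
qed

lemma enr_functional_linear:
  assumes "\<mu> > -1" "f \<in> CT v" "g \<in> CT v"
  shows "enr_functional \<mu> v j (\<lambda>x. a * f x + b * g x)
       = a * enr_functional \<mu> v j f + b * enr_functional \<mu> v j g"
proof -
  have h: "(\<lambda>x. a * f x + b * g x) \<in> CT v"
    using assms unfolding CT_def by (auto intro!: continuous_intros)
  let ?s = "\<lambda>t. t *\<^sub>R edge_midpoint v j + (1 - t) *\<^sub>R barycenter v"
  let ?w = "\<lambda>t. t powr \<mu> * (1 - t) powr \<mu>"
  have "(LINT t:{0..1}|lborel. ?w t * (a * f (?s t) + b * g (?s t)))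
      = (LINT t:{0..1}|lborel. a * (?w t * f (?s t)) + b * (?w t * g (?s t)))"
    by (simp add: algebra_simps)
  also have "\<dots> = a * (LINT t:{0..1}|lborel. ?w t * f (?s t))
      + b * (LINT t:{0..1}|lborel. ?w t * g (?s t))"
    using enr_functional_integrable[OF assms(1,2)] enr_functional_integrable[OF assms(1,3)]
    by (subst set_integral_add(2)) auto
  finally show ?thesis
    using assms h by (simp add: enr_functional_def)
qed

end

theory Submission
  imports Defs
begin

text \<open>
  Since \<open>\<phi>\<^sub>i = \<lambda>\<^sub>i (3 \<lambda>\<^sub>i - 2)\<close>, and on the segment from \<open>m\<^sup>*\<close> to \<open>m\<^sub>j\<close> one has
  \<open>\<lambda>\<^sub>j = (1 - t) / 3\<close> and \<open>\<lambda>\<^sub>i = (2 + t) / 6\<close> for \<open>i \<noteq> j\<close>, the matrix \<open>N\<close> has a constant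
  diagonal entry \<open>d = (M\<^sub>2 - M\<^sub>0) / 3\<close> and a constant off-diagonal entry \<open>e = (M\<^sub>2 - 4 M\<^sub>0) / 12\<close>,
  where \<open>M\<^sub>k\<close> is the \<open>k\<close>-th moment of the weight. Thus
  \<open>det N = (d - e)\<^sup>2 (d + 2 e)\<close> with \<open>d - e = M\<^sub>2 / 4 > 0\<close> and
  \<open>d + 2 e = M\<^sub>2 / 2 - M\<^sub>0 < 0\<close>, because \<open>0 < M\<^sub>2 \<le> M\<^sub>0\<close>.
\<close>

lemma barycentric_eqI:
  fixes v :: "3 \<Rightarrow> real^2"
  assumes "\<not> collinear {v 1, v 2, v 3}"
    and "(\<Sum>i\<in>UNIV. l $ i) = 1" "(\<Sum>i\<in>UNIV. l $ i *\<^sub>R v i) = x"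
  shows "barycentric v x = l"
  using barycentric_ex1[OF assms(1), of x] barycentric[OF assms(1), of x] assms(2,3) by blast

text \<open>The points 0, \<open>axis 1 1\<close> and \<open>axis 2 1\<close> form an affine frame
  of the plane. Having the coordinates explicitly affine in \<open>x\<close> yields their
  continuity, which the description in \<open>barycentric\<close> hides.\<close>

lemma barycentric_affine:
  fixes v :: "3 \<Rightarrow> real^2"
  assumes "\<not> collinear {v 1, v 2, v 3}"
  shows "barycentric v x = barycentric v 0
    + x $ 1 *\<^sub>R (barycentric v (axis 1 1) - barycentric v 0)
    + x $ 2 *\<^sub>R (barycentric v (axis 2 1) - barycentric v 0)"
proof (rule barycentric_eqI[OF assms])
  let ?b = "barycentric v"
  let ?l = "?b 0 + x $ 1 *\<^sub>R (?b (axis 1 1) - ?b 0) + x $ 2 *\<^sub>R (?b (axis 2 1) - ?b 0)"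
  show "(\<Sum>i\<in>UNIV. ?l $ i) = 1"
    by (simp add: sum.distrib sum_subtractf sum_distrib_left[symmetric] barycentric(1)[OF assms])
  have "(\<Sum>i\<in>UNIV. ?l $ i *\<^sub>R v i) = (\<Sum>i\<in>UNIV. ?b 0 $ i *\<^sub>R v i)
      + x $ 1 *\<^sub>R ((\<Sum>i\<in>UNIV. ?b (axis 1 1) $ i *\<^sub>R v i) - (\<Sum>i\<in>UNIV. ?b 0 $ i *\<^sub>R v i))
      + x $ 2 *\<^sub>R ((\<Sum>i\<in>UNIV. ?b (axis 2 1) $ i *\<^sub>R v i) - (\<Sum>i\<in>UNIV. ?b 0 $ i *\<^sub>R v i))"
    by (simp add: sum.distrib sum_subtractf scaleR_sum_right algebra_simps)
  also have "\<dots> = x"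
    by (simp add: barycentric(2)[OF assms] vec_eq_iff forall_2 axis_def)
  finally show "(\<Sum>i\<in>UNIV. ?l $ i *\<^sub>R v i) = x" .
qed

text \<open>\<open>enr_functional\<close> is \<open>undefined\<close> outside \<open>CT v\<close>,
  so membership must come before its integral can be evaluated.\<close>

lemma phi_in_CT:
  fixes v :: "3 \<Rightarrow> real^2"
  assumes "\<not> collinear {v 1, v 2, v 3}"
  shows "phi v i \<in> CT v"
proof -
  have "continuous_on (triangle v) (barycentric v)"
    by (subst barycentric_affine[OF assms, abs_def]) (intro continuous_intros)
  then show ?thesis
    unfolding CT_def phi_def by (auto intro!: continuous_intros)
qed

text \<open>Linear interpolation between the barycenter, with all coordinates 1/3, and the midpoint,
  with coordinate 0 at \<open>j\<close> and 1/2 elsewhere.\<close>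

lemma barycentric_segment:
  fixes v :: "3 \<Rightarrow> real^2"
  assumes "\<not> collinear {v 1, v 2, v 3}"
  shows "barycentric v (t *\<^sub>R edge_midpoint v j + (1 - t) *\<^sub>R barycenter v) =
    (\<chi> i. if i = j then (1 - t) / 3 else (2 + t) / 6)"
  using exhaust_3[of j]
  by (intro barycentric_eqI[OF assms])
     (auto simp: sum_3 edge_midpoint_1 edge_midpoint_2 edge_midpoint_3 barycenter_def
       vec_eq_iff field_simps)

lemma phi_segment:
  fixes v :: "3 \<Rightarrow> real^2"
  assumes "\<not> collinear {v 1, v 2, v 3}"
  shows "phi v i (t *\<^sub>R edge_midpoint v j + (1 - t) *\<^sub>R barycenter v) =
    (if i = j then (t\<^sup>2 - 1) / 3 else (t\<^sup>2 - 4) / 12)"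
  unfolding phi_def barycentric_segment[OF assms]
  using exhaust_3[of i] exhaust_3[of j]
  by (auto simp: three_cyclic power2_eq_square field_simps)

lemma jacobi_moment:
  fixes \<mu> :: real
  assumes "\<mu> > -1"
  shows "set_integrable lborel {0..1} (\<lambda>t. t powr \<mu> * (1 - t) powr \<mu> * t ^ k)" (is ?int)
    and "(LINT t:{0..1}|lborel. t powr \<mu> * (1 - t) powr \<mu> * t ^ k) = Beta (\<mu> + k + 1) (\<mu> + 1)"
proof -
  have eq: "t powr \<mu> * (1 - t) powr \<mu> * t ^ k = t powr (\<mu> + k + 1 - 1) * (1 - t) powr (\<mu> + 1 - 1)"
    if "t \<in> {0..1}" for t :: real
    \<comment> \<open>At \<open>t = 0\<close> both sides vanish, even for \<open>k = 0\<close>,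
      since \<open>0 powr a = 0\<close>.\<close>
    using that by (cases "t = 0") (auto simp: powr_add powr_realpow)
  have i: "set_integrable lborel {0..1}
      (\<lambda>t. t powr (\<mu> + k + 1 - 1) * (1 - t) powr (\<mu> + 1 - 1))"
    using assms by (intro integrable_Beta) auto
  then show ?int
    by (subst set_integrable_cong[OF refl refl eq])
  have "(LINT t:{0..1}|lborel. t powr \<mu> * (1 - t) powr \<mu> * t ^ k) =
      (LINT t:{0..1}|lborel. t powr (\<mu> + k + 1 - 1) * (1 - t) powr (\<mu> + 1 - 1))"
    using eq by (intro set_lebesgue_integral_cong) auto
  also have "\<dots> = Beta (\<mu> + k + 1) (\<mu> + 1)"
    using set_borel_integral_eq_integral(2)[OF i]
      has_integral_Beta_real[of "\<mu> + k + 1" "\<mu> + 1"] assms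
    by (simp add: integral_unique)
  finally show "(LINT t:{0..1}|lborel. t powr \<mu> * (1 - t) powr \<mu> * t ^ k)
      = Beta (\<mu> + k + 1) (\<mu> + 1)" .
qed

text \<open>The matrix is \<open>d - e\<close> times the identity plus \<open>e\<close> times the
  all-ones matrix, with eigenvalues \<open>d - e\<close> (twice) and
  \<open>d + 2 * e\<close>.\<close>

lemma det_constant_offdiagonal_3:
  fixes d e :: real
  shows "det (\<chi> j i. if i = j then d else e :: real^3^3) = (d - e)\<^sup>2 * (d + 2 * e)"
  by (simp add: det_3 power2_eq_square algebra_simps)

theorem theorem3p3:
  fixes v :: "3 \<Rightarrow> real^2" and \<mu> :: real
  assumes nondegenerate: "\<not> collinear {v 1, v 2, v 3}"
    and orientation: "counterclockwise v"
    and mu: "\<mu> > -1"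
  shows "admissible v (\<lambda>j. enr_functional \<mu> v j)"
proof -
  define w where "w t = t powr \<mu> * (1 - t) powr \<mu>" for t :: real
  define M where "M k = (LINT t:{0..1}|lborel. w t * t ^ k)" for k :: nat
  have int: "set_integrable lborel {0..1} (\<lambda>t. w t * t ^ k)" for k
    using jacobi_moment(1)[OF mu] by (simp add: w_def)
  have pos: "M k > 0" for k
    unfolding M_def w_def jacobi_moment(2)[OF mu] using mu
    by (auto simp: Beta_def intro!: divide_pos_pos mult_pos_pos Gamma_real_pos)
  have "M 2 \<le> M 0"
    unfolding M_def
    by (intro set_integral_mono int mult_left_mono) (auto simp: w_def power_le_one)
  have lin: "(LINT t:{0..1}|lborel. w t * ((t\<^sup>2 - a) / b)) = (M 2 - a * M 0) / b" for a b
  proof -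
    \<comment> \<open>The factor \<open>t ^ 0\<close> turns the constant term into the moment
      \<open>M 0\<close>.\<close>
    have "(LINT t:{0..1}|lborel. w t * ((t\<^sup>2 - a) / b)) =
        (LINT t:{0..1}|lborel. 1 / b * (w t * t ^ 2) - a / b * (w t * t ^ 0))"
      by (simp add: algebra_simps diff_divide_distrib)
    also have "\<dots> = 1 / b * M 2 - a / b * M 0"
      unfolding M_def
      using set_integral_diff(2)[OF set_integrable_mult_right[OF int[of 2], of "1 / b"]
          set_integrable_mult_right[OF int[of 0], of "a / b"]]
      by (simp only: set_integral_mult_right)
    finally show ?thesis by (simp add: diff_divide_distrib)
  qed
  have entry: "enr_functional \<mu> v j (phi v i) =
      (if i = j then (M 2 - M 0) / 3 else (M 2 - 4 * M 0) / 12)" for i j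
    \<comment> \<open>The two instances are the diagonal and off-diagonal cases of
      \<open>phi_segment\<close>.\<close>
    using lin[of 1 3] lin[of 4 12]
    by (simp add: enr_functional_def phi_in_CT[OF nondegenerate] phi_segment[OF nondegenerate]
        flip: w_def)
  have "det (\<chi> j i. enr_functional \<mu> v j (phi v i) :: real^3^3) =
      ((M 2 - M 0) / 3 - (M 2 - 4 * M 0) / 12)\<^sup>2 * ((M 2 - M 0) / 3 + 2 * ((M 2 - 4 * M 0) / 12))"
    unfolding entry by (rule det_constant_offdiagonal_3)
  also have "\<dots> = (M 2 / 4)\<^sup>2 * (M 2 / 2 - M 0)"
    by (simp add: power2_eq_square field_simps)
  also have "\<dots> \<noteq> 0"
    using pos[of 2] \<open>M 2 \<le> M 0\<close> by simp
  finally show ?thesis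
    unfolding admissible_def .
qed

end
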